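(* Let $F_1,\dots,F_k:\mathbb{Z}\to\mathbb{C}$ be C-finite sequences. For each $i$, suppose $F_i$ satisfies a linear recurrence with constant coefficients of minimal degree $D(i)$ whose characteristic polynomial has $d(i)$ distinct roots $r^{(i)}_1,\dots,r^{(i)}_{d(i)}$ (nonzero) with multiplicities $e^{(i)}_1,\dots,e^{(i)}_{d(i)}$, so $D(i)=\sum_je^{(i)}_j$; let $\Delta(i)=\max_{1\le j\le d(i)}(e^{(i)}_j-1)$. Let $a_i,b_i,c_i$ be integers with $a_i\ge0$, $a_i+b_i\ge0$, and for each $i$ not both zero, and for $n\ge0$ let $$f(n)=\sum_{j=0}^{n-1}F_1(a_1n+b_1j+c_1)F_2(a_2n+b_2j+c_2)\cdots F_k(a_kn+b_kj+c_k).$$ Then there exist complex constants $\alpha_{i_1,\dots,i_k}$ and complex polynomials $\psi_{i_1,\dots,i_k}$ (indexed by $0\le i_\nu\le D(\nu)-1$, $1\le\nu\le k$) such that for all $n\ge0$ $$f(n)=\sum\alpha_{i_1,\dots,i_k}F_1((a_1+b_1)n+i_1)\cdots F_k((a_k+b_k)n+i_k)+\sum\psi_{i_1,\dots,i_k}(n)F_1(a_1n+i_1)\cdots F_k(a_kn+i_k),$$ where the degree of each $\psi_{i_1,\dots,i_k}$ is at most: zero (i.e. $\psi$ is constant) if $\prod_{i=1}^k(r^{(i)}_{m_i})^{b_i}\neq1$ for all sequences $(m_1,\dots,m_k)$ with $1\le m_i\le d(i)$; and $1+\sum\{\Delta(i):a_i=0\}$ otherwise.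
   Context: Each $F_i$ has the form $F_i(n)=\sum_{m=1}^{d(i)}\sum_{h=0}^{e^{(i)}_m-1}\lambda^{(i)}_{m,h}n^h(r^{(i)}_m)^n$, which defines it on all integers. *)

theory Defs
  imports Complex_Main "HOL-Library.FuncSet" "HOL-Computational_Algebra.Computational_Algebra"
begin

(* The monic polynomial p = x^D - c_(D-1) x^(D-1) - ... - c_0 stands for the recurrence
   F(n+D) = c_(D-1) F(n+D-1) + ... + c_0 F(n), required at every integer n. *)
definition has_char_poly :: "(int \<Rightarrow> complex) \<Rightarrow> complex poly \<Rightarrow> bool" where
  "has_char_poly F p \<longleftrightarrow>
     lead_coeff p = 1 \<and> (\<forall>n. (\<Sum>i\<le>degree p. coeff p i * F (n + int i)) = 0)"

definition c_finite :: "(int \<Rightarrow> complex) \<Rightarrow> bool" where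
  "c_finite F \<longleftrightarrow> (\<exists>p. has_char_poly F p)"

(* Because the recurrence holds on all of the integers, a factor x of a characteristic
   polynomial can be cancelled; so the roots of a minimal one are automatically nonzero.
   The zero sequence has minimal characteristic polynomial 1. *)
definition min_char_poly :: "(int \<Rightarrow> complex) \<Rightarrow> complex poly \<Rightarrow> bool" where
  "min_char_poly F p \<longleftrightarrow>
     has_char_poly F p \<and> (\<forall>q. has_char_poly F q \<longrightarrow> degree p \<le> degree q)"

end

theory Submission
  imports Defs
begin

text \<open>
  Each \<open>F i\<close> is a combination of exponential monomials \<open>x ^ h * z powi x\<close> that lie in the span of the
  shifts of \<open>F i\<close>: if \<open>P(x) * z powi x\<close> lies in a shift-invariant space, then applying \<open>S - z\<close> repeatedly,
  with \<open>S\<close> the shift, lowers the degree of \<open>P\<close> one by one and so produces all monomials up to the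
  degree of \<open>P\<close>. By multilinearity it suffices to treat one exponential monomial per factor. Put
  \<open>\<rho> = (\<Prod>i\<in>I. z i powi b i)\<close>. If \<open>\<rho> \<noteq> 1\<close>, the sum over \<open>j\<close> has an antiderivative of the same shape,
  evaluated at \<open>j = n\<close> and \<open>j = 0\<close>; no polynomial coefficients appear. If \<open>\<rho> = 1\<close>, the sum is a
  polynomial in \<open>n\<close> of degree at most \<open>1 + (\<Sum>i\<in>I. h i)\<close> times \<open>\<Prod>i\<in>I. z i powi (a i * n)\<close>, and the powers
  of \<open>n\<close> can be absorbed by the factors with \<open>a i \<noteq> 0\<close> up to the stated degree.
\<close>

section \<open>Forward differences of polynomials\<close>

definition fdiff :: "complex poly \<Rightarrow> complex poly" where
  "fdiff P = pcompose P [:1, 1:] - P"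

lemma poly_fdiff: "poly (fdiff P) x = poly P (x + 1) - poly P x"
  by (simp add: fdiff_def poly_pcompose add.commute)

lemma fdiff_0 [simp]: "fdiff 0 = 0"
  by (simp add: fdiff_def)

lemma fdiff_add: "fdiff (P + Q) = fdiff P + fdiff Q"
  by (simp add: fdiff_def pcompose_add)

lemma fdiff_pCons: "fdiff (pCons a P) = pCons 0 (fdiff P) + fdiff P + P"
  by (rule poly_ext) (simp add: poly_fdiff algebra_simps)

text \<open>Without the degree bound, higher coefficients of \<open>P\<close> would contribute as
  well. Under it only the top one survives, so \<open>fdiff\<close> lowers the degree of a
  nonconstant polynomial by exactly one.\<close>

lemma coeff_fdiff:
  assumes "degree P \<le> Suc m"
  shows "coeff (fdiff P) m = of_nat (Suc m) * coeff P (Suc m)"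
  using assms
proof (induction P arbitrary: m)
  case 0
  then show ?case by simp
next
  case (pCons a P)
  have deg: "degree P \<le> m"
    using pCons.prems by (cases "P = 0") auto
  then have "coeff (fdiff P) m = 0"
    using pCons.IH[of m] by (simp add: coeff_eq_0)
  then show ?case
    using pCons.IH[of "m - 1"] deg
    by (cases m) (auto simp: fdiff_pCons algebra_simps)
qed

text \<open>Bounds are expressed by vanishing coefficients rather than by \<open>degree\<close>, so
  that the bound 0 means the zero polynomial and not a constant.\<close>

lemma coeff_fdiff_eq_0:
  assumes "\<And>i. i \<ge> Suc n \<Longrightarrow> coeff P i = 0" "i \<ge> n"
  shows "coeff (fdiff P) i = 0"
proof -
  have "degree P \<le> n"
    using assms(1) by (intro degree_le) auto
  then show ?thesis
    using coeff_fdiff[of P i] assms by simp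
qed

text \<open>Antidifferences are built from the top: a multiple of \<open>x ^ (n + 1)\<close> cancels
  the coefficient of \<open>x ^ n\<close>, and induction handles the rest.\<close>

lemma ex_fdiff_eq:
  assumes "\<And>i. i \<ge> n \<Longrightarrow> coeff P i = 0"
  shows "\<exists>Q. fdiff Q = P \<and> degree Q \<le> n"
  using assms
proof (induction n arbitrary: P)
  case 0
  then have "P = 0" by (intro poly_eqI) auto
  then show ?case by (intro exI[of _ 0]) auto
next
  case (Suc n)
  define Q0 where "Q0 = monom (coeff P n / of_nat (Suc n)) (Suc n)"
  have deg: "degree Q0 \<le> Suc n"
    unfolding Q0_def by (rule degree_monom_le)
  have "coeff (P - fdiff Q0) i = 0" if "i \<ge> n" for i
  proof -
    have "coeff (fdiff Q0) i = of_nat (Suc i) * coeff Q0 (Suc i)"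
      using deg that by (intro coeff_fdiff) auto
    then show ?thesis
      using that Suc.prems[of i] by (cases "i = n") (auto simp: Q0_def simp del: of_nat_Suc)
  qed
  from Suc.IH[OF this] obtain Q1 where Q1: "fdiff Q1 = P - fdiff Q0" "degree Q1 \<le> n"
    by blast
  have "fdiff (Q0 + Q1) = P"
    by (simp add: fdiff_add Q1)
  moreover have "degree (Q0 + Q1) \<le> Suc n"
    using deg Q1 by (intro degree_add_le) auto
  ultimately show ?case by blast
qed

lemma ex_poly_sum_powers:
  "\<exists>Q :: complex poly. degree Q \<le> Suc s \<and> (\<forall>n. (\<Sum>j<n. of_nat j ^ s) = poly Q (of_nat n))"
proof -
  obtain Q where Q: "fdiff Q = monom 1 s" "degree Q \<le> Suc s"
    using ex_fdiff_eq[of "Suc s" "monom 1 s"] by auto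
  have "(\<Sum>j<n. of_nat j ^ s) = poly (Q - [:poly Q 0:]) (of_nat n)" for n
  proof -
    have "(\<Sum>j<n. of_nat j ^ s) = (\<Sum>j<n. poly Q (of_nat (Suc j)) - poly Q (of_nat j))"
      using poly_fdiff[of Q] by (intro sum.cong) (auto simp: Q poly_monom add.commute)
    also have "\<dots> = poly Q (of_nat n) - poly Q (of_nat 0)"
      by (rule sum_lessThan_telescope)
    finally show ?thesis by simp
  qed
  moreover have "degree (Q - [:poly Q 0:]) \<le> Suc s"
    using Q by (intro degree_diff_le) auto
  ultimately show ?thesis by blast
qed

section \<open>Exponential polynomials in shift-invariant spaces\<close>

definition expoly :: "complex \<Rightarrow> complex poly \<Rightarrow> int \<Rightarrow> complex" where
  "expoly z P x = poly P (of_int x) * z powi x"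

lemma expoly_0 [simp]: "expoly z 0 x = 0"
  by (simp add: expoly_def)

lemma expoly_add: "expoly z (P + Q) x = expoly z P x + expoly z Q x"
  by (simp add: expoly_def algebra_simps)

lemma expoly_diff: "expoly z (P - Q) x = expoly z P x - expoly z Q x"
  by (simp add: expoly_def algebra_simps)

lemma expoly_smult: "expoly z (smult c P) x = c * expoly z P x"
  by (simp add: expoly_def algebra_simps)

text \<open>In operator form, \<open>S - z\<close> replaces \<open>P\<close> by \<open>z\<close>
  times \<open>fdiff P\<close>: the base is kept and the degree drops.\<close>

lemma expoly_Suc:
  assumes "z \<noteq> 0"
  shows "expoly z P (x + 1) = z * (expoly z P x + expoly z (fdiff P) x)"
  using assms by (simp add: expoly_def poly_fdiff power_int_add algebra_simps)

lemma expoly_altdef: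
  assumes "\<And>i. i \<ge> n \<Longrightarrow> coeff P i = 0"
  shows "expoly z P x = (\<Sum>h<n. coeff P h * expoly z (monom 1 h) x)"
proof -
  have "poly P (of_int x) = (\<Sum>h<n. coeff P h * of_int x ^ h)"
  proof (cases "P = 0")
    case False
    then have "degree P < n"
      using assms[of "degree P"] by (meson leading_coeff_0_iff not_le)
    then show ?thesis
      unfolding poly_altdef by (intro sum.mono_neutral_left) (auto simp: coeff_eq_0)
  qed auto
  then show ?thesis
    by (simp add: expoly_def poly_monom sum_distrib_right mult.assoc)
qed

definition shift_space :: "(int \<Rightarrow> complex) set \<Rightarrow> bool" where
  "shift_space M \<longleftrightarrow> (\<lambda>_. 0) \<in> M \<and>
     (\<forall>G\<in>M. \<forall>H\<in>M. (\<lambda>x. G x + H x) \<in> M) \<and>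
     (\<forall>G\<in>M. \<forall>c. (\<lambda>x. c * G x) \<in> M) \<and>
     (\<forall>G\<in>M. (\<lambda>x. G (x + 1)) \<in> M)"

context
  fixes M
  assumes M: "shift_space M"
begin

lemma shift_space_add: "G \<in> M \<Longrightarrow> H \<in> M \<Longrightarrow> (\<lambda>x. G x + H x) \<in> M"
  using M by (simp add: shift_space_def)

lemma shift_space_scale: "G \<in> M \<Longrightarrow> (\<lambda>x. c * G x) \<in> M"
  using M by (simp add: shift_space_def)

lemma shift_space_shift: "G \<in> M \<Longrightarrow> (\<lambda>x. G (x + 1)) \<in> M"
  using M by (simp add: shift_space_def)

lemma shift_space_diff: "G \<in> M \<Longrightarrow> H \<in> M \<Longrightarrow> (\<lambda>x. G x - H x) \<in> M"
  using shift_space_add[of G "\<lambda>x. -1 * H x"] shift_space_scale[of H "-1"] by simp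

lemma shift_space_sum: "(\<And>i. i \<in> A \<Longrightarrow> G i \<in> M) \<Longrightarrow> (\<lambda>x. \<Sum>i\<in>A. G i x) \<in> M"
proof (induction A rule: infinite_finite_induct)
  case (insert i A)
  then show ?case
    using shift_space_add[of "G i" "\<lambda>x. \<Sum>i\<in>A. G i x"] by simp
qed (use M in \<open>auto simp: shift_space_def\<close>)

lemma expoly_fdiff_mem:
  assumes "z \<noteq> 0" "expoly z P \<in> M"
  shows "expoly z (fdiff P) \<in> M"
proof -
  have "expoly z (fdiff P) = (\<lambda>x. inverse z * expoly z P (x + 1) - expoly z P x)"
    using assms(1) by (intro ext) (simp add: expoly_Suc flip: mult.assoc)
  also have "\<dots> \<in> M"
    by (intro shift_space_diff shift_space_scale shift_space_shift assms)
  finally show ?thesis .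
qed

text \<open>Induction on the degree: \<open>fdiff P\<close> has degree exactly one less, so it
  yields all lower monomials. The top one is recovered by subtracting these from
  \<open>expoly z P\<close> and dividing by the leading coefficient.\<close>

lemma expoly_monom_mem:
  assumes "z \<noteq> 0" "expoly z P \<in> M" "P \<noteq> 0" "h \<le> degree P"
  shows "expoly z (monom 1 h) \<in> M"
  using assms(2-)
proof (induction "degree P" arbitrary: P h)
  case 0
  then obtain c where c: "P = [:c:]" "c \<noteq> 0"
    by (metis degree_eq_zeroE pCons_eq_0_iff)
  have "expoly z (monom 1 h) = (\<lambda>x. inverse c * expoly z P x)"
    using 0 c by (auto simp: expoly_def)
  then show ?case
    using shift_space_scale 0 by simp
next
  case (Suc n)
  have lead: "coeff P (Suc n) \<noteq> 0"
    using Suc.hyps(2) Suc.prems(2) by (metis leading_coeff_0_iff)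
  have "coeff (fdiff P) n \<noteq> 0"
    using lead Suc.hyps(2) by (subst coeff_fdiff) (auto simp del: of_nat_Suc)
  moreover have "degree (fdiff P) \<le> n"
    using Suc.hyps(2) by (intro degree_le allI impI coeff_fdiff_eq_0[of "Suc n"]) (auto simp: coeff_eq_0)
  ultimately have "n = degree (fdiff P)" "fdiff P \<noteq> 0"
    by (auto intro: le_antisym le_degree)
  with Suc.hyps(1) Suc.prems(1) have IH: "expoly z (monom 1 h) \<in> M" if "h \<le> n" for h
    using that expoly_fdiff_mem assms(1) by blast
  show ?case
  proof (cases "h = Suc n")
    case True
    have "expoly z P x = (\<Sum>h<Suc (Suc n). coeff P h * expoly z (monom 1 h) x)" for x
      using Suc.hyps(2) by (intro expoly_altdef) (auto simp: coeff_eq_0)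
    then have "expoly z (monom 1 h) =
      (\<lambda>x. inverse (coeff P h) * (expoly z P x - (\<Sum>h<Suc n. coeff P h * expoly z (monom 1 h) x)))"
      using lead True by auto
    also have "\<dots> \<in> M"
      using Suc.prems IH
      by (intro shift_space_scale shift_space_diff shift_space_sum) auto
    finally show ?thesis .
  qed (use IH Suc in auto)
qed

text \<open>\<open>S - z\<close> sends \<open>expoly w P\<close> to
  \<open>(w - z) * expoly w P + w * expoly w (fdiff P)\<close>. Hence, if \<open>Q\<close> solves
  the equation for \<open>fdiff P\<close>, then \<open>(P - w * Q) / (w - z)\<close> solves it for
  \<open>P\<close>, without leaving \<open>M\<close>.\<close>

lemma ex_expoly_shift_minus:
  assumes "w \<noteq> 0" "w \<noteq> z" "expoly w P \<in> M" "\<And>i. i \<ge> n \<Longrightarrow> coeff P i = 0"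
  shows "\<exists>Q. expoly w Q \<in> M \<and> (\<forall>i\<ge>n. coeff Q i = 0) \<and>
    (\<forall>x. expoly w Q (x + 1) - z * expoly w Q x = expoly w P x)"
  using assms(3,4)
proof (induction n arbitrary: P)
  case 0
  then have "P = 0" by (intro poly_eqI) auto
  then show ?case using 0 by (intro exI[of _ 0]) auto
next
  case (Suc n)
  obtain Q where Q: "expoly w Q \<in> M" "\<And>i. i \<ge> n \<Longrightarrow> coeff Q i = 0"
      "\<And>x. expoly w Q (x + 1) - z * expoly w Q x = expoly w (fdiff P) x"
    using Suc.IH[OF expoly_fdiff_mem[OF assms(1) Suc.prems(1)]] Suc.prems(2) coeff_fdiff_eq_0
    by metis
  define Q' where "Q' = smult (inverse (w - z)) (P - smult w Q)"
  have Q': "expoly w Q' = (\<lambda>x. inverse (w - z) * (expoly w P x - w * expoly w Q x))"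
    by (intro ext) (simp add: Q'_def expoly_smult expoly_diff)
  have "expoly w Q' \<in> M"
    unfolding Q' by (intro shift_space_scale shift_space_diff Suc.prems Q)
  moreover have "\<forall>i\<ge>Suc n. coeff Q' i = 0"
    using Q(2) Suc.prems(2) by (auto simp: Q'_def)
  moreover have "expoly w Q' (x + 1) - z * expoly w Q' x = expoly w P x" for x
  proof -
    have "expoly w Q' (x + 1) - z * expoly w Q' x = inverse (w - z) *
        (expoly w P (x + 1) - z * expoly w P x - w * (expoly w Q (x + 1) - z * expoly w Q x))"
      by (simp add: Q' algebra_simps)
    also have "\<dots> = inverse (w - z) * ((w - z) * expoly w P x)"
      unfolding Q(3) unfolding expoly_Suc[OF assms(1)] by (simp add: algebra_simps)
    finally show ?thesis using assms(2) by simp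
  qed
  ultimately show ?case by blast
qed

end

section \<open>Decomposition of C-finite sequences\<close>

text \<open>The operator \<open>p(S)\<close> applied to \<open>G\<close>, with \<open>S\<close> the
  shift; a characteristic polynomial of \<open>G\<close> is a monic \<open>p\<close> with
  \<open>p(S) G = 0\<close>.\<close>

definition char_apply :: "complex poly \<Rightarrow> (int \<Rightarrow> complex) \<Rightarrow> int \<Rightarrow> complex" where
  "char_apply p G n = (\<Sum>i\<le>degree p. coeff p i * G (n + int i))"

lemma char_apply_altdef:
  assumes "degree p \<le> N"
  shows "char_apply p G n = (\<Sum>i\<le>N. coeff p i * G (n + int i))"
  unfolding char_apply_def using assms
  by (intro sum.mono_neutral_left) (auto simp: coeff_eq_0)

text \<open>This is \<open>p(S) = q(S) (S - z)\<close> for \<open>p = (x - z) q\<close>; it allows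
  roots to be split off one at a time.\<close>

lemma char_apply_linear_factor:
  "char_apply ([:- z, 1:] * q) G = char_apply q (\<lambda>x. G (x + 1) - z * G x)"
proof
  fix n
  let ?N = "degree q"
  have "[:- z, 1:] * q = pCons 0 q - smult z q"
    by simp
  moreover have "degree ([:- z, 1:] * q) \<le> Suc ?N"
    using degree_mult_le[of "[:- z, 1:]" q] by simp
  ultimately have "char_apply ([:- z, 1:] * q) G n =
      (\<Sum>i\<le>Suc ?N. coeff (pCons 0 q - smult z q) i * G (n + int i))"
    using char_apply_altdef by metis
  also have "\<dots> = (\<Sum>i\<le>Suc ?N. coeff (pCons 0 q) i * G (n + int i)) -
      z * (\<Sum>i\<le>Suc ?N. coeff q i * G (n + int i))"
    by (simp only: coeff_diff coeff_smult left_diff_distrib sum_subtractf sum_distrib_left mult.assoc)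
  also have "(\<Sum>i\<le>Suc ?N. coeff (pCons 0 q) i * G (n + int i)) =
      (\<Sum>i\<le>?N. coeff q i * G (n + int i + 1))"
    by (subst sum.atMost_Suc_shift) (simp add: algebra_simps)
  also have "(\<Sum>i\<le>Suc ?N. coeff q i * G (n + int i)) = (\<Sum>i\<le>?N. coeff q i * G (n + int i))"
    by (simp add: coeff_eq_0)
  finally show "char_apply ([:- z, 1:] * q) G n = char_apply q (\<lambda>x. G (x + 1) - z * G x) n"
    by (simp add: char_apply_def algebra_simps sum_subtractf sum_distrib_left)
qed

lemma periodic_int_constant:
  fixes f :: "int \<Rightarrow> 'a"
  assumes "\<And>x. f (x + 1) = f x"
  shows "f x = f 0"
proof (induction x rule: int_induct[where k = 0])
  case (step2 i)
  then show ?case using assms[of "i - 1"] by simp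
qed (use assms in auto)

text \<open>Induction on the degree, splitting off a root \<open>z\<close>. Components at other
  roots are pulled back through \<open>S - z\<close> with unchanged bounds; the component at
  \<open>z\<close> needs an antidifference, which costs one degree and matches the increased
  multiplicity.\<close>

lemma expoly_decomposition:
  assumes M: "shift_space M"
    and "G \<in> M" "p \<noteq> 0" "\<And>z. poly p z = 0 \<Longrightarrow> z \<noteq> 0" "\<And>n. char_apply p G n = 0"
  shows "\<exists>P. (\<forall>x. G x = (\<Sum>z | poly p z = 0. expoly z (P z) x)) \<and>
    (\<forall>z. poly p z = 0 \<longrightarrow> expoly z (P z) \<in> M) \<and> (\<forall>z. \<forall>i\<ge>order z p. coeff (P z) i = 0)"
  using assms(2-)
proof (induction "degree p" arbitrary: p G)
  case 0
  then obtain c where c: "p = [:c:]" "c \<noteq> 0"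
    by (metis degree_eq_zeroE pCons_eq_0_iff)
  then have "G x = 0" for x
    using "0.prems"(4)[of x] by (simp add: char_apply_def)
  then show ?case
    using c by (intro exI[of _ "\<lambda>_. 0"]) auto
next
  case (Suc N)
  obtain z where z: "poly p z = 0"
    using Suc.hyps(2) fundamental_theorem_of_algebra[of p] by (auto simp: constant_degree)
  then obtain q where q: "p = [:- z, 1:] * q"
    by (auto simp: poly_eq_0_iff_dvd)
  have "q \<noteq> 0" using q Suc.prems(2) by auto
  have "z \<noteq> 0" using Suc.prems(3) z by blast
  have "degree p = Suc (degree q)"
    unfolding q using \<open>q \<noteq> 0\<close> by (subst degree_mult_eq) auto
  then have deg: "N = degree q" using Suc.hyps(2) by simp
  define A where "A = {w. poly p w = 0}"
  have "finite A" unfolding A_def using Suc.prems(2) by (rule poly_roots_finite)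
  have A: "A = insert z {w. poly q w = 0}"
    unfolding A_def q by auto
  have ord: "order w p = order w q" if "w \<noteq> z" for w
  proof -
    have "order w [:- z, 1:] = 0"
      using that by (intro order_0I) auto
    then show ?thesis
      using Suc.prems(2) unfolding q by (subst order_mult) auto
  qed
  have ordz: "order z p = Suc (order z q)"
    using order_power_n_n[of z 1] Suc.prems(2) unfolding q by (subst order_mult) auto
  \<comment> \<open>\<open>H = (S - z) G\<close> is annihilated by \<open>q\<close>, so the
    induction hypothesis expands it.\<close>
  define H where "H = (\<lambda>x. G (x + 1) - z * G x)"
  have "H \<in> M" unfolding H_def
    by (intro shift_space_diff[OF M] shift_space_scale[OF M] shift_space_shift[OF M] Suc.prems)
  moreover have "char_apply q H n = 0" for n
    using Suc.prems(4)[of n] unfolding q char_apply_linear_factor H_def .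
  moreover have "w \<noteq> 0" if "poly q w = 0" for w
    using that Suc.prems(3)[of w] by (simp add: q)
  ultimately obtain P where P: "\<And>x. H x = (\<Sum>w | poly q w = 0. expoly w (P w) x)"
      "\<And>w. poly q w = 0 \<Longrightarrow> expoly w (P w) \<in> M" "\<And>w i. i \<ge> order w q \<Longrightarrow> coeff (P w) i = 0"
    using Suc.hyps(1)[OF deg _ \<open>q \<noteq> 0\<close>] by blast
  \<comment> \<open>If \<open>z\<close> is no longer a root of \<open>q\<close>, its order there is
    0, which forces \<open>P z = 0\<close>; so the sum may be taken over all of
    \<open>A\<close>.\<close>
  have H: "H x = expoly z (P z) x + (\<Sum>w\<in>A - {z}. expoly w (P w) x)" for x
  proof -
    have "H x = (\<Sum>w\<in>A. expoly w (P w) x)"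
    proof (unfold P, rule sum.mono_neutral_left)
      show "\<forall>w\<in>A - {w. poly q w = 0}. expoly w (P w) x = 0"
      proof
        fix w assume "w \<in> A - {w. poly q w = 0}"
        then have "P w = 0"
          using P(3)[of w] by (intro poly_eqI) (auto simp: order_0I)
        then show "expoly w (P w) x = 0" by simp
      qed
    qed (use A \<open>finite A\<close> in auto)
    then show ?thesis
      using \<open>finite A\<close> A sum.remove[of A z "\<lambda>w. expoly w (P w) x"] by auto
  qed
  have "\<exists>Q. expoly w Q \<in> M \<and> (\<forall>i\<ge>order w q. coeff Q i = 0) \<and>
    (\<forall>x. expoly w Q (x + 1) - z * expoly w Q x = expoly w (P w) x)" if "w \<in> A - {z}" for w
    using that A Suc.prems(3)[of w] P by (intro ex_expoly_shift_minus M) (auto simp: A_def)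
  then obtain Q where Q: "\<And>w. w \<in> A - {z} \<Longrightarrow> expoly w (Q w) \<in> M"
      "\<And>w i. w \<in> A - {z} \<Longrightarrow> i \<ge> order w q \<Longrightarrow> coeff (Q w) i = 0"
      "\<And>w x. w \<in> A - {z} \<Longrightarrow> expoly w (Q w) (x + 1) - z * expoly w (Q w) x = expoly w (P w) x"
    by metis
  \<comment> \<open>Once the preimages at the other roots are subtracted, \<open>(S - z) K\<close>
    involves the base \<open>z\<close> only.\<close>
  define K where "K = (\<lambda>x. G x - (\<Sum>w\<in>A - {z}. expoly w (Q w) x))"
  have "K \<in> M" unfolding K_def
    using Q Suc.prems by (intro shift_space_diff[OF M] shift_space_sum[OF M])
  have K: "K (x + 1) - z * K x = expoly z (P z) x" for x
  proof -
    have "K (x + 1) - z * K x =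
        H x - (\<Sum>w\<in>A - {z}. expoly w (Q w) (x + 1) - z * expoly w (Q w) x)"
      by (simp add: K_def H_def sum_subtractf sum_distrib_left algebra_simps)
    also have "(\<Sum>w\<in>A - {z}. expoly w (Q w) (x + 1) - z * expoly w (Q w) x) =
        (\<Sum>w\<in>A - {z}. expoly w (P w) x)"
      by (intro sum.cong Q) auto
    finally show ?thesis by (simp add: H)
  qed
  \<comment> \<open>The factor \<open>inverse z\<close> cancels the \<open>z\<close> in
    \<open>expoly_Suc\<close>; the bound grows by one, as permitted by \<open>ordz\<close>.\<close>
  obtain R where R: "fdiff R = smult (inverse z) (P z)" "degree R \<le> order z q"
    using ex_fdiff_eq[of "order z q" "smult (inverse z) (P z)"] P(3)[of z] by auto
  \<comment> \<open>\<open>K - expoly z R\<close> lies in the kernel of \<open>S - z\<close>;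
    divided by \<open>z powi x\<close> it becomes periodic, hence constant, and this constant is
    added to \<open>R\<close>.\<close>
  define f where "f = (\<lambda>x. (K x - expoly z R x) * z powi (- x))"
  have "f (x + 1) = f x" for x
  proof -
    have "K (x + 1) = z * K x + expoly z (P z) x"
      using K[of x] by (simp add: algebra_simps)
    then have "K (x + 1) - expoly z R (x + 1) = z * (K x - expoly z R x)"
      unfolding expoly_Suc[OF \<open>z \<noteq> 0\<close>] R expoly_smult using \<open>z \<noteq> 0\<close>
      by (simp add: algebra_simps)
    then show ?thesis
      using \<open>z \<noteq> 0\<close> by (simp add: f_def power_int_add power_int_minus)
  qed
  then have const: "f x = f 0" for x by (rule periodic_int_constant)
  have Keq: "K x = expoly z (R + [:f 0:]) x" for x
    using const[of x] \<open>z \<noteq> 0\<close> unfolding f_def expoly_def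
    by (simp add: power_int_minus field_simps)
  define P' where "P' = Q(z := R + [:f 0:])"
  have "expoly w (P' w) \<in> M" if "poly p w = 0" for w
  proof (cases "w = z")
    case True
    moreover have "expoly z (R + [:f 0:]) = K" by (intro ext) (simp only: Keq)
    ultimately show ?thesis using \<open>K \<in> M\<close> by (simp add: P'_def)
  qed (use Q that in \<open>auto simp: P'_def A_def\<close>)
  moreover have "G x = (\<Sum>w\<in>A. expoly w (P' w) x)" for x
  proof -
    have "(\<Sum>w\<in>A. expoly w (P' w) x) = expoly z (P' z) x + (\<Sum>w\<in>A - {z}. expoly w (P' w) x)"
      using \<open>finite A\<close> A by (intro sum.remove) auto
    also have "(\<Sum>w\<in>A - {z}. expoly w (P' w) x) = (\<Sum>w\<in>A - {z}. expoly w (Q w) x)"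
      by (intro sum.cong) (auto simp: P'_def)
    finally show ?thesis
      using Keq[of x] by (simp add: P'_def K_def algebra_simps)
  qed
  moreover have "coeff (P' w) i = 0" if "w \<in> A" "i \<ge> order w p" for w i
    using that R(2) ord[of w] ordz Q(2)[of w i]
    by (cases "w = z") (auto simp: P'_def coeff_eq_0 coeff_pCons split: nat.splits)
  \<comment> \<open>Off the roots the order is 0, so the coefficient condition over all
    \<open>z\<close> demands the zero polynomial there.\<close>
  ultimately show ?case
    unfolding A_def
    by (intro exI[of _ "\<lambda>w. if poly p w = 0 then P' w else 0"]) auto
qed

section \<open>The span of the shifts of a C-finite sequence\<close>

text \<open>With \<open>D\<close> the degree of the recurrence, these are combinations of exactly
  the shifts that the closed form may use.\<close>

definition shift_span :: "(int \<Rightarrow> complex) \<Rightarrow> nat \<Rightarrow> (int \<Rightarrow> complex) set" where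
  "shift_span F D = {G. \<exists>\<gamma>. \<forall>x. G x = (\<Sum>t<D. \<gamma> t * F (x + int t))}"

lemma shift_span_generator:
  assumes "t < D"
  shows "(\<lambda>x. F (x + int t)) \<in> shift_span F D"
proof -
  have "F (x + int t) = (\<Sum>s<D. (if s = t then 1 else 0) * F (x + int s))" for x
    using assms by (simp add: if_distrib[of "\<lambda>u. u * _"] cong: if_cong)
  then show ?thesis
    unfolding shift_span_def by (intro CollectI exI[of _ "\<lambda>s. if s = t then 1 else 0"] allI)
qed

text \<open>Only closure under the shift uses the recurrence: the one new term
  \<open>F (x + D)\<close> is a combination of lower shifts because \<open>p\<close> is
  monic.\<close>

lemma shift_space_shift_span:
  assumes "has_char_poly F p"
  shows "shift_space (shift_span F (degree p))"
proof -
  let ?D = "degree p" and ?M = "shift_span F (degree p)"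
  have zero: "(\<lambda>_. 0) \<in> ?M"
    unfolding shift_span_def by (auto intro!: exI[of _ "\<lambda>_. 0"])
  have add: "(\<lambda>x. G x + H x) \<in> ?M" if GH: "G \<in> ?M" "H \<in> ?M" for G H
  proof -
    obtain g h where "\<And>x. G x = (\<Sum>t<?D. g t * F (x + int t))"
        "\<And>x. H x = (\<Sum>t<?D. h t * F (x + int t))"
      using GH unfolding shift_span_def by blast
    then show ?thesis
      unfolding shift_span_def
      by (auto intro!: exI[of _ "\<lambda>t. g t + h t"] simp: sum.distrib algebra_simps)
  qed
  have scale: "(\<lambda>x. c * G x) \<in> ?M" if G: "G \<in> ?M" for G c
  proof -
    obtain g where "\<And>x. G x = (\<Sum>t<?D. g t * F (x + int t))"
      using G unfolding shift_span_def by blast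
    then show ?thesis
      unfolding shift_span_def
      by (auto intro!: exI[of _ "\<lambda>t. c * g t"] simp: sum_distrib_left algebra_simps)
  qed
  have sum: "(\<lambda>x. \<Sum>i\<in>A. G i x) \<in> ?M" if "\<And>i. i \<in> A \<Longrightarrow> G i \<in> ?M" for A :: "nat set" and G
    using that
  proof (induction A rule: infinite_finite_induct)
    case (insert i A)
    then show ?case using add[of "G i" "\<lambda>x. \<Sum>i\<in>A. G i x"] by simp
  qed (use zero in auto)
  note gen = shift_span_generator[of _ ?D F]
  have top: "(\<lambda>x. F (x + int ?D)) \<in> ?M"
  proof -
    have "F (x + int ?D) = (\<Sum>t<?D. (- coeff p t) * F (x + int t))" for x
    proof -
      have "(\<Sum>i\<le>?D. coeff p i * F (x + int i)) = 0" "lead_coeff p = 1"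
        using assms by (auto simp: has_char_poly_def)
      then show ?thesis
        by (simp add: sum.lessThan_Suc flip: lessThan_Suc_atMost)
           (simp add: sum_negf eq_neg_iff_add_eq_0 add.commute)
    qed
    then show ?thesis
      unfolding shift_span_def by (auto intro!: exI[of _ "\<lambda>t. - coeff p t"])
  qed
  have shift: "(\<lambda>x. G (x + 1)) \<in> ?M" if G: "G \<in> ?M" for G
  proof -
    obtain g where g: "\<And>x. G x = (\<Sum>t<?D. g t * F (x + int t))"
      using G unfolding shift_span_def by blast
    have "(\<lambda>x. F (x + int (Suc t))) \<in> ?M" if "t < ?D" for t
      using that gen[of "Suc t"] top by (cases "Suc t = ?D") auto
    then have "(\<lambda>x. \<Sum>t<?D. g t * F (x + int (Suc t))) \<in> ?M"
      by (intro sum scale) auto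
    then show ?thesis by (simp add: g algebra_simps)
  qed
  show ?thesis
    unfolding shift_space_def using zero add scale shift by blast
qed

text \<open>\<open>E\<close> asks for all lower exponents as well, since these appear later when
  powers of sums are expanded or powers of \<open>n\<close> are redistributed.\<close>

lemma c_finite_expansion:
  assumes F: "has_char_poly F p" and nz: "\<And>z. poly p z = 0 \<Longrightarrow> z \<noteq> 0"
  defines "E \<equiv> {(z, h). poly p z = 0 \<and> h < order z p \<and>
    (\<forall>g\<le>h. expoly z (monom 1 g) \<in> shift_span F (degree p))}"
  shows "finite E" "\<exists>\<mu>. \<forall>x. F (x + c) = (\<Sum>(z, h)\<in>E. \<mu> z h * expoly z (monom 1 h) x)"
proof -
  let ?M = "shift_span F (degree p)"
  have "p \<noteq> 0" using F by (auto simp: has_char_poly_def)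
  then have fin: "finite {z. poly p z = 0}" by (rule poly_roots_finite)
  let ?S = "SIGMA z:{z. poly p z = 0}. {..<order z p}"
  have sub: "E \<subseteq> ?S" unfolding E_def by auto
  moreover have "finite ?S" using fin by auto
  ultimately show "finite E" by (rule finite_subset)
  have M: "shift_space ?M" by (rule shift_space_shift_span[OF F])
  have "F \<in> ?M"
  proof (cases "degree p = 0")
    case True
    then have "F x = 0" for x using F by (auto simp: has_char_poly_def)
    then show ?thesis by (auto simp: shift_span_def)
  next
    case False
    then show ?thesis using shift_span_generator[of 0] by simp
  qed
  moreover have "char_apply p F n = 0" for n
    using F by (simp add: char_apply_def has_char_poly_def)
  ultimately obtain P where P: "\<And>x. F x = (\<Sum>z | poly p z = 0. expoly z (P z) x)"
      "\<And>z. poly p z = 0 \<Longrightarrow> expoly z (P z) \<in> ?M" "\<And>z i. i \<ge> order z p \<Longrightarrow> coeff (P z) i = 0"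
    using expoly_decomposition[OF M _ \<open>p \<noteq> 0\<close> nz] by blast
  \<comment> \<open>\<open>Q z\<close> is the polynomial part at base \<open>z\<close> after
    translation by \<open>c\<close>, which does not raise the degree.\<close>
  define Q where "Q = (\<lambda>z. smult (z powi c) (pcompose (P z) [:of_int c, 1:]))"
  have degQ: "degree (Q z) \<le> degree (P z)" for z
    unfolding Q_def using degree_pcompose_le[of "P z" "[:of_int c, 1:]"]
    by (intro order.trans[OF degree_smult_le]) simp
  have Q0: "coeff (Q z) i = 0" if "i \<ge> order z p" for z i
  proof (cases "P z = 0")
    case False
    then have "degree (P z) < order z p"
      using P(3) by (meson leading_coeff_0_iff not_le)
    then show ?thesis using degQ[of z] that by (intro coeff_eq_0) auto
  qed (simp add: Q_def)
  \<comment> \<open>A nonzero coefficient has an exponent at most \<open>degree (P z)\<close>, so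
    \<open>expoly_monom_mem\<close> puts this monomial and all lower ones into the span.\<close>
  have notE: "coeff (Q z) h = 0" if "(z, h) \<in> ?S - E" for z h
  proof (rule ccontr)
    assume nz': "coeff (Q z) h \<noteq> 0"
    then have "h \<le> degree (P z)" "P z \<noteq> 0"
      using degQ[of z] le_degree[of "Q z" h] by (auto simp: Q_def)
    then have "expoly z (monom 1 g) \<in> ?M" if "g \<le> h" for g
      using that \<open>(z, h) \<in> ?S - E\<close> nz P(2)[of z]
      by (intro expoly_monom_mem[OF M, of z "P z"]) auto
    then show False using that by (auto simp: E_def)
  qed
  have "F (x + c) = (\<Sum>(z, h)\<in>E. coeff (Q z) h * expoly z (monom 1 h) x)" for x
  proof -
    have "expoly z (P z) (x + c) = (\<Sum>h<order z p. coeff (Q z) h * expoly z (monom 1 h) x)"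
      if "poly p z = 0" for z
    proof -
      have "expoly z (P z) (x + c) = expoly z (Q z) x"
        using nz[OF that]
        by (simp add: expoly_def Q_def poly_pcompose power_int_add algebra_simps)
      then show ?thesis using expoly_altdef[of "order z p" "Q z"] Q0 by simp
    qed
    then have "F (x + c) =
        (\<Sum>z | poly p z = 0. \<Sum>h<order z p. coeff (Q z) h * expoly z (monom 1 h) x)"
      unfolding P(1) by (intro sum.cong) auto
    also have "\<dots> = (\<Sum>(z, h)\<in>?S. coeff (Q z) h * expoly z (monom 1 h) x)"
      using fin by (intro sum.Sigma) auto
    also have "\<dots> = (\<Sum>(z, h)\<in>E. coeff (Q z) h * expoly z (monom 1 h) x)"
      using sub \<open>finite ?S\<close> notE by (intro sum.mono_neutral_right) auto
    finally show ?thesis .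
  qed
  then show "\<exists>\<mu>. \<forall>x. F (x + c) = (\<Sum>(z, h)\<in>E. \<mu> z h * expoly z (monom 1 h) x)"
    by (intro exI[of _ "\<lambda>z. coeff (Q z)"]) auto
qed

section \<open>Sums of products\<close>

text \<open>Greedy choice: each index takes as much of \<open>q\<close> as its bound allows. This
  serves to spread a power of \<open>n\<close> over several factors.\<close>

lemma ex_sum_eq_bounded:
  fixes h :: "'i \<Rightarrow> nat"
  assumes "finite J" "q \<le> (\<Sum>i\<in>J. h i)"
  shows "\<exists>g. (\<forall>i. g i \<le> h i) \<and> (\<forall>i. i \<notin> J \<longrightarrow> g i = 0) \<and> (\<Sum>i\<in>J. g i) = q"
  using assms
proof (induction J arbitrary: q)
  case empty
  then show ?case by (intro exI[of _ "\<lambda>_. 0"]) auto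
next
  case (insert x J)
  define r where "r = min q (h x)"
  have "q - r \<le> (\<Sum>i\<in>J. h i)"
    using insert.prems insert.hyps by (simp add: r_def)
  from insert.IH[OF this] obtain g where g: "\<And>i. g i \<le> h i" "\<And>i. i \<notin> J \<Longrightarrow> g i = 0"
      "(\<Sum>i\<in>J. g i) = q - r"
    by blast
  have "(\<Sum>i\<in>J. (g(x := r)) i) = (\<Sum>i\<in>J. g i)"
    using insert.hyps by (intro sum.cong) auto
  then show ?case
    using g insert.hyps by (intro exI[of _ "g(x := r)"]) (auto simp: r_def)
qed

lemma expoly_monom_add:
  assumes "z \<noteq> 0"
  shows "expoly z (monom 1 h) (x + b) =
    z powi b * (\<Sum>g\<le>h. of_nat (h choose g) * of_int b ^ (h - g) * expoly z (monom 1 g) x)"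
  using assms
  by (simp add: expoly_def poly_monom binomial_ring power_int_add sum_distrib_left
      sum_distrib_right mult_ac)

lemma prod_expoly_add:
  assumes "finite I" "\<And>i. i \<in> I \<Longrightarrow> z i \<noteq> 0"
  shows "(\<Prod>i\<in>I. expoly (z i) (monom 1 (h i)) (x i + b i)) = (\<Prod>i\<in>I. z i powi b i) *
    (\<Sum>g\<in>(\<Pi>\<^sub>E i\<in>I. {..h i}). (\<Prod>i\<in>I. of_nat (h i choose g i) * of_int (b i) ^ (h i - g i)) *
       (\<Prod>i\<in>I. expoly (z i) (monom 1 (g i)) (x i)))"
proof -
  have "(\<Prod>i\<in>I. expoly (z i) (monom 1 (h i)) (x i + b i)) = (\<Prod>i\<in>I. z i powi b i *
      (\<Sum>g\<le>h i. of_nat (h i choose g) * of_int (b i) ^ (h i - g) * expoly (z i) (monom 1 g) (x i)))"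
    using assms(2) by (intro prod.cong) (auto simp: expoly_monom_add)
  then show ?thesis
    using assms(1) by (simp add: prod.distrib prod_sum_PiE)
qed

text \<open>In the expansion \<open>prod_expoly_add\<close>, \<open>restrict h I\<close> indexes the
  leading term; that all others have smaller total exponent supplies the induction measure for
  \<open>nonresonant_sum\<close>.\<close>

lemma sum_PiE_less:
  fixes h :: "'i \<Rightarrow> nat"
  assumes "finite I" "g \<in> (\<Pi>\<^sub>E i\<in>I. {..h i})" "g \<noteq> restrict h I"
  shows "(\<Sum>i\<in>I. g i) < (\<Sum>i\<in>I. h i)"
proof (rule sum_strict_mono_ex1[OF assms(1)])
  show le: "\<forall>i\<in>I. g i \<le> h i" using assms(2) by auto
  have "\<exists>i\<in>I. g i \<noteq> h i"
  proof (rule ccontr)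
    assume "\<not> ?thesis"
    then have "g = restrict h I"
      by (intro PiE_ext[OF assms(2), of "restrict h I"]) auto
    with assms(3) show False by blast
  qed
  with le show "\<exists>i\<in>I. g i < h i" by (meson le_neq_implies_less)
qed

text \<open>Multiplying out gives terms \<open>n ^ u * j ^ v\<close> with
  \<open>u + v = (\<Sum>i\<in>I. h i)\<close>. Summing \<open>j ^ v\<close> gives a polynomial of
  degree at most \<open>v + 1\<close>, whence the extra 1.\<close>

lemma ex_poly_sum_prod_linear:
  fixes a b :: "'i \<Rightarrow> complex"
  assumes "finite I"
  shows "\<exists>Q. degree Q \<le> 1 + (\<Sum>i\<in>I. h i) \<and>
    (\<forall>n. (\<Sum>j<n. \<Prod>i\<in>I. (a i * of_nat n + b i * of_nat j) ^ h i) = poly Q (of_nat n))"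
proof -
  obtain S :: "nat \<Rightarrow> complex poly" where S: "\<And>s. degree (S s) \<le> Suc s"
      "\<And>s n. (\<Sum>j<n. of_nat j ^ s) = poly (S s) (of_nat n)"
    using ex_poly_sum_powers by metis
  let ?X = "\<Pi>\<^sub>E i\<in>I. {..h i}"
  define C where "C = (\<lambda>g. \<Prod>i\<in>I. of_nat (h i choose g i) * a i ^ g i * b i ^ (h i - g i))"
  define u where "u = (\<lambda>g :: 'i \<Rightarrow> nat. \<Sum>i\<in>I. g i)"
  define v where "v = (\<lambda>g. \<Sum>i\<in>I. h i - g i)"
  define Q where "Q = (\<Sum>g\<in>?X. smult (C g) (monom 1 (u g) * S (v g)))"
  have uv: "u g + v g = (\<Sum>i\<in>I. h i)" if "g \<in> ?X" for g
    unfolding u_def v_def sum.distrib[symmetric] using that by (intro sum.cong) (auto simp: PiE_iff)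
  have "degree Q \<le> 1 + (\<Sum>i\<in>I. h i)"
    unfolding Q_def
  proof (rule degree_sum_le)
    fix g assume g: "g \<in> ?X"
    have "degree (smult (C g) (monom 1 (u g) * S (v g))) \<le> degree (monom (1::complex) (u g)) + degree (S (v g))"
      by (intro order.trans[OF degree_smult_le] degree_mult_le)
    also have "\<dots> \<le> u g + Suc (v g)"
      by (intro add_mono degree_monom_le S)
    finally show "degree (smult (C g) (monom 1 (u g) * S (v g))) \<le> 1 + (\<Sum>i\<in>I. h i)"
      using uv[OF g] by simp
  qed (use assms in \<open>auto intro: finite_PiE\<close>)
  moreover have "(\<Sum>j<n. \<Prod>i\<in>I. (a i * of_nat n + b i * of_nat j) ^ h i) = poly Q (of_nat n)" for n
  proof -
    have "(\<Prod>i\<in>I. (a i * of_nat n + b i * of_nat j) ^ h i) =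
        (\<Sum>g\<in>?X. C g * of_nat n ^ u g * of_nat j ^ v g)" for j
    proof -
      have "(\<Prod>i\<in>I. (a i * of_nat n + b i * of_nat j) ^ h i) = (\<Prod>i\<in>I. \<Sum>g\<le>h i.
          of_nat (h i choose g) * (a i * of_nat n) ^ g * (b i * of_nat j) ^ (h i - g))"
        by (simp add: binomial_ring)
      also have "\<dots> = (\<Sum>g\<in>?X. \<Prod>i\<in>I. of_nat (h i choose g i) * (a i * of_nat n) ^ g i *
          (b i * of_nat j) ^ (h i - g i))"
        using assms by (intro prod_sum_PiE) auto
      also have "\<dots> = (\<Sum>g\<in>?X. C g * of_nat n ^ u g * of_nat j ^ v g)"
        by (simp add: C_def u_def v_def prod.distrib power_mult_distrib power_sum mult_ac)
      finally show ?thesis .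
    qed
    then have "(\<Sum>j<n. \<Prod>i\<in>I. (a i * of_nat n + b i * of_nat j) ^ h i) =
        (\<Sum>g\<in>?X. \<Sum>j<n. C g * of_nat n ^ u g * of_nat j ^ v g)"
      by (simp add: sum.swap[of _ ?X])
    also have "\<dots> = poly Q (of_nat n)"
      by (simp add: Q_def poly_sum poly_monom S(2)[symmetric] sum_distrib_left mult.assoc)
    finally show ?thesis .
  qed
  ultimately show ?thesis by blast
qed

section \<open>Closed forms with bounded polynomial degree\<close>

locale product_sum =
  fixes I :: "'i set" and F :: "'i \<Rightarrow> int \<Rightarrow> complex" and D :: "'i \<Rightarrow> nat"
    and a b :: "'i \<Rightarrow> int"
  assumes finite_I: "finite I"
begin

text \<open>The claimed shape is packaged as a vector space of functions, so that linear
  combinations need no explicit coefficients.\<close>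

definition closed_forms :: "nat \<Rightarrow> (nat \<Rightarrow> complex) set" where
  "closed_forms B = {f. \<exists>\<alpha> \<psi>.
     (\<forall>n. f n =
        (\<Sum>t\<in>(\<Pi>\<^sub>E i\<in>I. {..<D i}). \<alpha> t * (\<Prod>i\<in>I. F i ((a i + b i) * int n + int (t i)))) +
        (\<Sum>t\<in>(\<Pi>\<^sub>E i\<in>I. {..<D i}).
          poly (\<psi> t) (of_nat n) * (\<Prod>i\<in>I. F i (a i * int n + int (t i))))) \<and>
     (\<forall>t\<in>(\<Pi>\<^sub>E i\<in>I. {..<D i}). degree (\<psi> t) \<le> B)}"

lemma closed_formsI:
  assumes "\<And>n. f n =
        (\<Sum>t\<in>(\<Pi>\<^sub>E i\<in>I. {..<D i}). \<alpha> t * (\<Prod>i\<in>I. F i ((a i + b i) * int n + int (t i)))) +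
        (\<Sum>t\<in>(\<Pi>\<^sub>E i\<in>I. {..<D i}).
          poly (\<psi> t) (of_nat n) * (\<Prod>i\<in>I. F i (a i * int n + int (t i))))"
    and "\<And>t. degree (\<psi> t) \<le> B"
  shows "f \<in> closed_forms B"
  unfolding closed_forms_def using assms by blast

lemma closed_formsE:
  assumes "f \<in> closed_forms B"
  obtains \<alpha> \<psi> where "\<And>n. f n =
        (\<Sum>t\<in>(\<Pi>\<^sub>E i\<in>I. {..<D i}). \<alpha> t * (\<Prod>i\<in>I. F i ((a i + b i) * int n + int (t i)))) +
        (\<Sum>t\<in>(\<Pi>\<^sub>E i\<in>I. {..<D i}).
          poly (\<psi> t) (of_nat n) * (\<Prod>i\<in>I. F i (a i * int n + int (t i))))"
    and "\<And>t. degree (\<psi> t) \<le> B"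
proof -
  obtain \<alpha> \<psi> where *: "\<forall>n. f n =
        (\<Sum>t\<in>(\<Pi>\<^sub>E i\<in>I. {..<D i}). \<alpha> t * (\<Prod>i\<in>I. F i ((a i + b i) * int n + int (t i)))) +
        (\<Sum>t\<in>(\<Pi>\<^sub>E i\<in>I. {..<D i}).
          poly (\<psi> t) (of_nat n) * (\<Prod>i\<in>I. F i (a i * int n + int (t i))))"
     "\<forall>t\<in>(\<Pi>\<^sub>E i\<in>I. {..<D i}). degree (\<psi> t) \<le> B"
    using assms unfolding closed_forms_def by blast
  \<comment> \<open>Setting \<open>\<psi>\<close> to 0 outside the index set makes the degree bound
    hold for every \<open>t\<close>.\<close>
  show ?thesis
    by (rule that[of \<alpha> "\<lambda>t. if t \<in> (\<Pi>\<^sub>E i\<in>I. {..<D i}) then \<psi> t else 0"]) (use * in auto)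
qed

lemma closed_forms_zero: "(\<lambda>_. 0) \<in> closed_forms B"
  by (rule closed_formsI[of _ "\<lambda>_. 0" "\<lambda>_. 0"]) auto

lemma closed_forms_add:
  assumes "f \<in> closed_forms B" "g \<in> closed_forms B"
  shows "(\<lambda>n. f n + g n) \<in> closed_forms B"
proof -
  obtain \<alpha> \<psi> where f: "\<And>n. f n =
        (\<Sum>t\<in>(\<Pi>\<^sub>E i\<in>I. {..<D i}). \<alpha> t * (\<Prod>i\<in>I. F i ((a i + b i) * int n + int (t i)))) +
        (\<Sum>t\<in>(\<Pi>\<^sub>E i\<in>I. {..<D i}).
          poly (\<psi> t) (of_nat n) * (\<Prod>i\<in>I. F i (a i * int n + int (t i))))" "\<And>t. degree (\<psi> t) \<le> B"
    using assms(1) by (rule closed_formsE) blast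
  obtain \<alpha>' \<psi>' where g: "\<And>n. g n =
        (\<Sum>t\<in>(\<Pi>\<^sub>E i\<in>I. {..<D i}). \<alpha>' t * (\<Prod>i\<in>I. F i ((a i + b i) * int n + int (t i)))) +
        (\<Sum>t\<in>(\<Pi>\<^sub>E i\<in>I. {..<D i}).
          poly (\<psi>' t) (of_nat n) * (\<Prod>i\<in>I. F i (a i * int n + int (t i))))" "\<And>t. degree (\<psi>' t) \<le> B"
    using assms(2) by (rule closed_formsE) blast
  show ?thesis
    by (rule closed_formsI[of _ "\<lambda>t. \<alpha> t + \<alpha>' t" "\<lambda>t. \<psi> t + \<psi>' t"])
       (use f(2) g(2) in \<open>auto simp: f(1) g(1) distrib_right sum.distrib intro: degree_add_le\<close>)
qed

lemma closed_forms_scale: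
  assumes "f \<in> closed_forms B"
  shows "(\<lambda>n. c * f n) \<in> closed_forms B"
proof -
  obtain \<alpha> \<psi> where f: "\<And>n. f n =
        (\<Sum>t\<in>(\<Pi>\<^sub>E i\<in>I. {..<D i}). \<alpha> t * (\<Prod>i\<in>I. F i ((a i + b i) * int n + int (t i)))) +
        (\<Sum>t\<in>(\<Pi>\<^sub>E i\<in>I. {..<D i}).
          poly (\<psi> t) (of_nat n) * (\<Prod>i\<in>I. F i (a i * int n + int (t i))))" "\<And>t. degree (\<psi> t) \<le> B"
    using assms(1) by (rule closed_formsE) blast
  show ?thesis
    by (rule closed_formsI[of _ "\<lambda>t. c * \<alpha> t" "\<lambda>t. smult c (\<psi> t)"])
       (use f(2) in \<open>auto simp: f(1) distrib_left sum_distrib_left mult.assoc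
          intro: order.trans[OF degree_smult_le]\<close>)
qed

lemma closed_forms_diff:
  "f \<in> closed_forms B \<Longrightarrow> g \<in> closed_forms B \<Longrightarrow> (\<lambda>n. f n - g n) \<in> closed_forms B"
  using closed_forms_add[of f B "\<lambda>n. -1 * g n"] closed_forms_scale[of g B "-1"] by simp

lemma closed_forms_sum:
  "(\<And>x. x \<in> A \<Longrightarrow> f x \<in> closed_forms B) \<Longrightarrow> (\<lambda>n. \<Sum>x\<in>A. f x n) \<in> closed_forms B"
proof (induction A rule: infinite_finite_induct)
  case (insert x A)
  then show ?case
    using closed_forms_add[of "f x" B "\<lambda>n. \<Sum>x\<in>A. f x n"] by simp
qed (auto simp: closed_forms_zero)

text \<open>The product is multiplied out; \<open>C\<close> is independent of the arguments
  \<open>x\<close>, so the same coefficients serve for every \<open>n\<close>.\<close>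

lemma prod_shift_span:
  assumes "\<And>i. i \<in> I \<Longrightarrow> G i \<in> shift_span (F i) (D i)"
  obtains C where "\<And>x. (\<Prod>i\<in>I. G i (x i)) =
    (\<Sum>t\<in>(\<Pi>\<^sub>E i\<in>I. {..<D i}). C t * (\<Prod>i\<in>I. F i (x i + int (t i))))"
proof -
  have "\<forall>i\<in>I. \<exists>\<gamma>. \<forall>x. G i x = (\<Sum>t<D i. \<gamma> t * F i (x + int t))"
    using assms unfolding shift_span_def by blast
  then obtain \<gamma> where \<gamma>: "\<And>i x. i \<in> I \<Longrightarrow> G i x = (\<Sum>t<D i. \<gamma> i t * F i (x + int t))"
    by metis
  show ?thesis
  proof (rule that[of "\<lambda>t. \<Prod>i\<in>I. \<gamma> i (t i)"])
    fix x
    have "(\<Prod>i\<in>I. G i (x i)) = (\<Prod>i\<in>I. \<Sum>t<D i. \<gamma> i t * F i (x i + int t))"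
      using \<gamma> by (intro prod.cong) auto
    also have "\<dots> = (\<Sum>t\<in>(\<Pi>\<^sub>E i\<in>I. {..<D i}). \<Prod>i\<in>I. \<gamma> i (t i) * F i (x i + int (t i)))"
      using finite_I by (intro prod_sum_PiE) auto
    finally show "(\<Prod>i\<in>I. G i (x i)) = (\<Sum>t\<in>(\<Pi>\<^sub>E i\<in>I. {..<D i}).
        (\<Prod>i\<in>I. \<gamma> i (t i)) * (\<Prod>i\<in>I. F i (x i + int (t i))))"
      by (simp add: prod.distrib)
  qed
qed

text \<open>Boundary terms at \<open>j = n\<close> have these arguments; they go entirely into the
  \<alpha> part, so any \<open>B\<close> is allowed.\<close>

lemma closed_forms_upper:
  assumes "\<And>i. i \<in> I \<Longrightarrow> G i \<in> shift_span (F i) (D i)"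
  shows "(\<lambda>n. \<Prod>i\<in>I. G i ((a i + b i) * int n)) \<in> closed_forms B"
proof -
  obtain C where "\<And>x. (\<Prod>i\<in>I. G i (x i)) =
      (\<Sum>t\<in>(\<Pi>\<^sub>E i\<in>I. {..<D i}). C t * (\<Prod>i\<in>I. F i (x i + int (t i))))"
    using prod_shift_span[OF assms] by blast
  then show ?thesis
    by (intro closed_formsI[of _ C "\<lambda>_. 0"]) auto
qed

lemma closed_forms_lower:
  assumes "\<And>i. i \<in> I \<Longrightarrow> G i \<in> shift_span (F i) (D i)" "s \<le> B"
  shows "(\<lambda>n. of_nat n ^ s * (\<Prod>i\<in>I. G i (a i * int n))) \<in> closed_forms B"
proof -
  obtain C where "\<And>x. (\<Prod>i\<in>I. G i (x i)) =
      (\<Sum>t\<in>(\<Pi>\<^sub>E i\<in>I. {..<D i}). C t * (\<Prod>i\<in>I. F i (x i + int (t i))))"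
    using prod_shift_span[OF assms(1)] by blast
  then show ?thesis
    using assms(2)
    by (intro closed_formsI[of _ "\<lambda>_. 0" "\<lambda>t. monom (C t) s"])
       (auto simp: poly_monom sum_distrib_left mult_ac intro: order.trans[OF degree_monom_le])
qed

section \<open>Sums with one exponential monomial per factor\<close>

context
  fixes z :: "'i \<Rightarrow> complex" and h :: "'i \<Rightarrow> nat"
  assumes z: "\<And>i. i \<in> I \<Longrightarrow> z i \<noteq> 0"
    and mem: "\<And>i g. i \<in> I \<Longrightarrow> g \<le> h i \<Longrightarrow> expoly (z i) (monom 1 g) \<in> shift_span (F i) (D i)"
begin

text \<open>Advancing the summand from \<open>j\<close> to \<open>j + 1\<close> multiplies it by \<open>\<rho>\<close> and adds summands with smaller
  exponents. Since \<open>\<rho> \<noteq> 1\<close>, the sum is a telescoping one modulo sums covered by induction on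
  \<open>\<Sum>i\<in>I. h i\<close>.\<close>

lemma nonresonant_sum:
  assumes \<rho>: "(\<Prod>i\<in>I. z i powi b i) \<noteq> 1"
  shows "(\<lambda>n. \<Sum>j<n. \<Prod>i\<in>I. expoly (z i) (monom 1 (h i)) (a i * int n + b i * int j))
    \<in> closed_forms B"
proof -
  define \<rho> where "\<rho> = (\<Prod>i\<in>I. z i powi b i)"
  define W where "W = (\<lambda>g n j. \<Prod>i\<in>I. expoly (z i) (monom 1 (g i)) (a i * int n + b i * int j))"
  \<comment> \<open>The claim is generalised to all exponents below \<open>h\<close>, because they
    occur in the induction step and are covered by \<open>mem\<close>.\<close>
  have "(\<lambda>n. \<Sum>j<n. W g n j) \<in> closed_forms B" if "\<forall>i\<in>I. g i \<le> h i" for g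
    using that
  proof (induction "\<Sum>i\<in>I. g i" arbitrary: g rule: less_induct)
    case less
    define X where "X = (\<Pi>\<^sub>E i\<in>I. {..g i})"
    define C :: "('i \<Rightarrow> nat) \<Rightarrow> complex"
      where "C = (\<lambda>u. \<Prod>i\<in>I. of_nat (g i choose u i) * of_int (b i) ^ (g i - u i))"
    have "finite X" unfolding X_def using finite_I by (intro finite_PiE) auto
    \<comment> \<open>The leading index reproduces \<open>W g\<close> with coefficient 1.\<close>
    have top: "restrict g I \<in> X" "C (restrict g I) = 1" "W (restrict g I) = W g"
      by (auto simp: X_def C_def W_def)
    have "W g n (Suc j) = \<rho> * W g n j + \<rho> * (\<Sum>u\<in>X - {restrict g I}. C u * W u n j)" for n j
    proof -
      have "W g n (Suc j) =
          (\<Prod>i\<in>I. expoly (z i) (monom 1 (g i)) (a i * int n + b i * int j + b i))"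
        unfolding W_def by (simp add: algebra_simps)
      also have "\<dots> = \<rho> * (\<Sum>u\<in>X. C u * W u n j)"
        using prod_expoly_add[OF finite_I z, where x = "\<lambda>i. a i * int n + b i * int j"]
        unfolding \<rho>_def X_def C_def W_def by simp
      also have "(\<Sum>u\<in>X. C u * W u n j) = W g n j + (\<Sum>u\<in>X - {restrict g I}. C u * W u n j)"
        using \<open>finite X\<close> top by (simp add: sum.remove)
      finally show ?thesis by (simp add: distrib_left)
    qed
    then have "W g n (Suc j) - W g n j =
        (\<rho> - 1) * W g n j + \<rho> * (\<Sum>u\<in>X - {restrict g I}. C u * W u n j)" for n j
      by (simp add: algebra_simps)
    \<comment> \<open>Summation over \<open>j\<close> telescopes the left side; since
      \<open>\<rho> \<noteq> 1\<close>, the relation can be solved for the sum of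
      \<open>W g\<close>.\<close>
    then have "W g n n - W g n 0 = (\<rho> - 1) * (\<Sum>j<n. W g n j) +
        \<rho> * (\<Sum>u\<in>X - {restrict g I}. C u * (\<Sum>j<n. W u n j))" for n
      unfolding sum_lessThan_telescope[symmetric]
      by (simp add: sum.distrib sum_distrib_left sum.swap[of _ "{..<n}"])
    then have "(\<lambda>n. \<Sum>j<n. W g n j) = (\<lambda>n. inverse (\<rho> - 1) *
        (W g n n - W g n 0 - \<rho> * (\<Sum>u\<in>X - {restrict g I}. C u * (\<Sum>j<n. W u n j))))"
      using \<rho> by (intro ext) (simp add: \<rho>_def)
    also have "\<dots> \<in> closed_forms B"
    proof (intro closed_forms_scale closed_forms_diff closed_forms_sum)
      show "(\<lambda>n. W g n n) \<in> closed_forms B"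
        using closed_forms_upper[of "\<lambda>i. expoly (z i) (monom 1 (g i))"] mem less.prems
        by (simp add: W_def distrib_right)
      \<comment> \<open>The exponent of \<open>n\<close> in \<open>closed_forms_lower\<close> is 0
        here, so even \<open>B = 0\<close> suffices.\<close>
      show "(\<lambda>n. W g n 0) \<in> closed_forms B"
        using closed_forms_lower[of "\<lambda>i. expoly (z i) (monom 1 (g i))" 0] mem less.prems
        by (simp add: W_def)
      fix u assume u: "u \<in> X - {restrict g I}"
      then have "(\<Sum>i\<in>I. u i) < (\<Sum>i\<in>I. g i)"
        using sum_PiE_less[OF finite_I] by (auto simp: X_def)
      moreover have "\<forall>i\<in>I. u i \<le> h i"
        using u less.prems by (fastforce simp: X_def PiE_iff)
      ultimately show "(\<lambda>n. \<Sum>j<n. W u n j) \<in> closed_forms B"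
        by (rule less.hyps)
    qed
    finally show ?case .
  qed
  from this[of h] show ?thesis by (simp add: W_def)
qed

text \<open>A power \<open>n ^ q\<close> is distributed over the factors with \<open>a i \<noteq> 0\<close>; only the excess, coming from
  the factors with \<open>a i = 0\<close>, has to be put into the polynomial coefficient.\<close>

lemma power_times_prod_closed_form:
  assumes "q \<le> 1 + (\<Sum>i\<in>I. h i)" "1 + (\<Sum>i\<in>{i\<in>I. a i = 0}. h i) \<le> B"
  shows "(\<lambda>n. of_nat n ^ q * (\<Prod>i\<in>I. z i powi (a i * int n))) \<in> closed_forms B"
proof -
  let ?J = "{i\<in>I. a i \<noteq> 0}" and ?Z = "{i\<in>I. a i = 0}"
  have "(\<Sum>i\<in>I. h i) = (\<Sum>i\<in>?J. h i) + (\<Sum>i\<in>?Z. h i)"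
    using finite_I by (subst sum.union_disjoint[symmetric]) (auto intro: sum.cong)
  \<comment> \<open>\<open>s\<close> is the part of \<open>q\<close> that the factors with
    \<open>a i \<noteq> 0\<close> cannot hold; truncated subtraction gives 0 if there is
    none.\<close>
  then obtain s where s: "s \<le> B" "s \<le> q" "q - s \<le> (\<Sum>i\<in>?J. h i)"
    using assms by (intro that[of "q - (\<Sum>i\<in>?J. h i)"]) auto
  obtain g where g: "\<And>i. g i \<le> h i" "\<And>i. i \<notin> ?J \<Longrightarrow> g i = 0" "(\<Sum>i\<in>?J. g i) = q - s"
    using ex_sum_eq_bounded[OF _ s(3)] finite_I by auto
  have "(\<Sum>i\<in>I. g i) = (\<Sum>i\<in>?J. g i)"
    using finite_I g(2) by (intro sum.mono_neutral_right) auto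
  then have q: "q = s + (\<Sum>i\<in>I. g i)" using s g by simp
  define c where "c = (\<Prod>i\<in>I. (of_int (a i) :: complex) ^ g i)"
  \<comment> \<open>Where \<open>a i = 0\<close> also \<open>g i = 0\<close>, so that factor is
    \<open>0 ^ 0 = 1\<close>.\<close>
  have "c \<noteq> 0"
    using finite_I g(2) by (auto simp: c_def)
  moreover have "(\<Prod>i\<in>I. expoly (z i) (monom 1 (g i)) (a i * int n)) =
      c * of_nat n ^ (\<Sum>i\<in>I. g i) * (\<Prod>i\<in>I. z i powi (a i * int n))" for n
    by (simp add: expoly_def poly_monom c_def prod.distrib power_mult_distrib power_sum)
  ultimately have "(\<lambda>n. of_nat n ^ q * (\<Prod>i\<in>I. z i powi (a i * int n))) = (\<lambda>n. inverse c *
      (of_nat n ^ s * (\<Prod>i\<in>I. expoly (z i) (monom 1 (g i)) (a i * int n))))"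
    by (intro ext) (simp add: q power_add)
  also have "\<dots> \<in> closed_forms B"
    using mem g s by (intro closed_forms_scale closed_forms_lower) auto
  finally show ?thesis .
qed

text \<open>The powers \<open>z i powi (b i * j)\<close> multiply to \<open>1 ^ j = 1\<close>. What
  remains under the sum is a product of powers of linear forms in \<open>n\<close> and
  \<open>j\<close>, which sums to a polynomial in \<open>n\<close>.\<close>

lemma resonant_sum:
  assumes \<rho>: "(\<Prod>i\<in>I. z i powi b i) = 1"
    and B: "1 + (\<Sum>i\<in>{i\<in>I. a i = 0}. h i) \<le> B"
  shows "(\<lambda>n. \<Sum>j<n. \<Prod>i\<in>I. expoly (z i) (monom 1 (h i)) (a i * int n + b i * int j))
    \<in> closed_forms B"
proof -
  obtain Q :: "complex poly" where Q: "degree Q \<le> 1 + (\<Sum>i\<in>I. h i)" "\<And>n. (\<Sum>j<n. \<Prod>i\<in>I.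
      (of_int (a i) * of_nat n + of_int (b i) * of_nat j) ^ h i) = poly Q (of_nat n)"
    using ex_poly_sum_prod_linear[OF finite_I, of h "\<lambda>i. of_int (a i)" "\<lambda>i. of_int (b i)"] by blast
  have "(\<Prod>i\<in>I. expoly (z i) (monom 1 (h i)) (a i * int n + b i * int j)) =
      (\<Prod>i\<in>I. z i powi (a i * int n)) *
      (\<Prod>i\<in>I. (of_int (a i) * of_nat n + of_int (b i) * of_nat j) ^ h i)" for n j
  proof -
    have "(\<Prod>i\<in>I. expoly (z i) (monom 1 (h i)) (a i * int n + b i * int j)) =
        (\<Prod>i\<in>I. z i powi (a i * int n) * (z i powi b i) ^ j *
          (of_int (a i) * of_nat n + of_int (b i) * of_nat j) ^ h i)"
      using z by (intro prod.cong)
        (auto simp: expoly_def poly_monom power_int_add power_int_mult)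
    then show ?thesis
      using \<rho> by (simp add: prod.distrib flip: prod_power_distrib)
  qed
  then have "(\<Sum>j<n. \<Prod>i\<in>I. expoly (z i) (monom 1 (h i)) (a i * int n + b i * int j)) =
      (\<Prod>i\<in>I. z i powi (a i * int n)) * poly Q (of_nat n)" for n
    unfolding Q(2)[symmetric] by (simp add: sum_distrib_left)
  then have "(\<Sum>j<n. \<Prod>i\<in>I. expoly (z i) (monom 1 (h i)) (a i * int n + b i * int j)) =
      (\<Sum>q\<le>degree Q. coeff Q q * (of_nat n ^ q * (\<Prod>i\<in>I. z i powi (a i * int n))))" for n
    by (simp add: poly_altdef sum_distrib_left mult_ac)
  moreover have "(\<lambda>n. \<Sum>q\<le>degree Q. coeff Q q * (of_nat n ^ q * (\<Prod>i\<in>I. z i powi (a i * int n))))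
      \<in> closed_forms B"
    using Q(1) B
    by (intro closed_forms_sum closed_forms_scale power_times_prod_closed_form) auto
  ultimately show ?thesis by simp
qed

end

end

section \<open>Expansion of the product into exponential monomials\<close>

theorem theorem17:
  fixes k :: nat
    and F :: "nat \<Rightarrow> int \<Rightarrow> complex"
    and p :: "nat \<Rightarrow> complex poly"
    and D d \<Delta> :: "nat \<Rightarrow> nat"
    and r :: "nat \<Rightarrow> nat \<Rightarrow> complex"
    and e :: "nat \<Rightarrow> nat \<Rightarrow> nat"
    and a b c :: "nat \<Rightarrow> int"
  assumes "k \<ge> 1"
    and "\<And>i. i \<in> {1..k} \<Longrightarrow> c_finite (F i)"
    and "\<And>i. i \<in> {1..k} \<Longrightarrow> min_char_poly (F i) (p i)"
    and "\<And>i. i \<in> {1..k} \<Longrightarrow> D i = degree (p i)"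
    and "\<And>i. i \<in> {1..k} \<Longrightarrow> bij_betw (r i) {1..d i} {z. poly (p i) z = 0}"
    and "\<And>i m. i \<in> {1..k} \<Longrightarrow> m \<in> {1..d i} \<Longrightarrow> r i m \<noteq> 0"
    and "\<And>i m. i \<in> {1..k} \<Longrightarrow> m \<in> {1..d i} \<Longrightarrow> e i m = order (r i m) (p i)"
    and "\<And>i. i \<in> {1..k} \<Longrightarrow> \<Delta> i = (MAX j\<in>{1..d i}. e i j - 1)"
    and "\<And>i. i \<in> {1..k} \<Longrightarrow> a i \<ge> 0"
    and "\<And>i. i \<in> {1..k} \<Longrightarrow> a i + b i \<ge> 0"
    and "\<And>i. i \<in> {1..k} \<Longrightarrow> \<not> (a i = 0 \<and> a i + b i = 0)"
  shows "\<exists>(\<alpha> :: (nat \<Rightarrow> nat) \<Rightarrow> complex) (\<psi> :: (nat \<Rightarrow> nat) \<Rightarrow> complex poly).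
    (\<forall>n::nat. (\<Sum>j<n. \<Prod>i=1..k. F i (a i * int n + b i * int j + c i)) =
        (\<Sum>t\<in>(\<Pi>\<^sub>E \<nu>\<in>{1..k}. {..<D \<nu>}).
           \<alpha> t * (\<Prod>i=1..k. F i ((a i + b i) * int n + int (t i)))) +
        (\<Sum>t\<in>(\<Pi>\<^sub>E \<nu>\<in>{1..k}. {..<D \<nu>}).
           poly (\<psi> t) (of_nat n) * (\<Prod>i=1..k. F i (a i * int n + int (t i))))) \<and>
    (\<forall>t\<in>(\<Pi>\<^sub>E \<nu>\<in>{1..k}. {..<D \<nu>}).
        degree (\<psi> t) \<le>
          (if \<forall>m\<in>(\<Pi>\<^sub>E i\<in>{1..k}. {1..d i}). (\<Prod>i=1..k. r i (m i) powi b i) \<noteq> 1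
           then 0
           else 1 + (\<Sum>i\<in>{i\<in>{1..k}. a i = 0}. \<Delta> i)))"
proof -
  let ?B = "if \<forall>m\<in>(\<Pi>\<^sub>E i\<in>{1..k}. {1..d i}). (\<Prod>i=1..k. r i (m i) powi b i) \<noteq> 1
    then 0 else 1 + (\<Sum>i\<in>{i\<in>{1..k}. a i = 0}. \<Delta> i)"
  interpret product_sum "{1..k}" F D a b
    by standard simp
  define E where "E = (\<lambda>i. {(z, h). poly (p i) z = 0 \<and> h < order z (p i) \<and>
    (\<forall>g\<le>h. expoly z (monom 1 g) \<in> shift_span (F i) (D i))})"
  have root: "\<exists>m\<in>{1..d i}. r i m = z" if "i \<in> {1..k}" "poly (p i) z = 0" for i z
    using bij_betw_imp_surj_on[OF assms(5)[OF that(1)]] that(2) by force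
  have nz: "z \<noteq> 0" if "i \<in> {1..k}" "poly (p i) z = 0" for i z
    using root[OF that] assms(6) that(1) by blast
  have E: "finite (E i)" "\<exists>\<mu>. \<forall>x. F i (x + c i) = (\<Sum>(z, h)\<in>E i. \<mu> z h * expoly z (monom 1 h) x)"
    if i: "i \<in> {1..k}" for i
    using c_finite_expansion[of "F i" "p i"] nz[OF i] assms(3,4)[OF i]
    unfolding E_def min_char_poly_def by auto
  have "\<forall>i\<in>{1..k}. \<exists>\<mu>. \<forall>x. F i (x + c i) = (\<Sum>(z, h)\<in>E i. \<mu> z h * expoly z (monom 1 h) x)"
    using E(2) by blast
  from bchoice[OF this] obtain \<mu> where \<mu>: "\<And>i x. i \<in> {1..k} \<Longrightarrow>
      F i (x + c i) = (\<Sum>(z, h)\<in>E i. \<mu> i z h * expoly z (monom 1 h) x)"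
    by blast
  \<comment> \<open>An element \<open>u\<close> of \<open>T\<close> selects one pair of root and
    exponent for each factor; the product expands over these selections.\<close>
  define T where "T = (\<Pi>\<^sub>E i\<in>{1..k}. E i)"
  define W where "W = (\<lambda>u n j.
    \<Prod>i=1..k. expoly (fst (u i)) (monom 1 (snd (u i))) (a i * int n + b i * int j))"
  define C where "C = (\<lambda>u. \<Prod>i=1..k. \<mu> i (fst (u i)) (snd (u i)))"
  have "(\<Prod>i=1..k. F i (a i * int n + b i * int j + c i)) = (\<Sum>u\<in>T. C u * W u n j)" for n j :: nat
  proof -
    have "(\<Prod>i=1..k. F i (a i * int n + b i * int j + c i)) = (\<Prod>i=1..k. \<Sum>v\<in>E i.
        \<mu> i (fst v) (snd v) * expoly (fst v) (monom 1 (snd v)) (a i * int n + b i * int j))"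
      by (intro prod.cong) (auto simp: \<mu> case_prod_unfold)
    also have "\<dots> = (\<Sum>u\<in>T. C u * W u n j)"
      unfolding T_def using E(1) by (subst prod_sum_PiE) (auto simp: C_def W_def prod.distrib)
    finally show ?thesis .
  qed
  then have "(\<lambda>n. \<Sum>j<n. \<Prod>i=1..k. F i (a i * int n + b i * int j + c i)) =
      (\<lambda>n. \<Sum>u\<in>T. C u * (\<Sum>j<n. W u n j))"
    by (intro ext) (simp add: sum.swap[of _ T] sum_distrib_left)
  also have "\<dots> \<in> closed_forms ?B"
  proof (intro closed_forms_sum closed_forms_scale)
    fix u assume "u \<in> T"
    then have "u i \<in> E i" if "i \<in> {1..k}" for i
      using that by (auto simp: T_def)
    then have u: "poly (p i) (fst (u i)) = 0" "snd (u i) < order (fst (u i)) (p i)"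
        "\<And>g. g \<le> snd (u i) \<Longrightarrow> expoly (fst (u i)) (monom 1 g) \<in> shift_span (F i) (D i)"
      if "i \<in> {1..k}" for i
      using that by (auto simp: E_def case_prod_unfold)
    \<comment> \<open>The selected roots are translated into indices of the enumeration
      \<open>r\<close>, in which the degree condition is stated.\<close>
    obtain m where m: "\<And>i. i \<in> {1..k} \<Longrightarrow> m i \<in> {1..d i} \<and> r i (m i) = fst (u i)"
      using bchoice[of "{1..k}" "\<lambda>i m. m \<in> {1..d i} \<and> r i m = fst (u i)"] root u(1) by blast
    show "(\<lambda>n. \<Sum>j<n. W u n j) \<in> closed_forms ?B"
    \<comment> \<open>The split is made for each term: nonresonant terms fit any bound, while a
      single resonant selection already puts \<open>?B\<close> into its second case.\<close>
    proof (cases "(\<Prod>i=1..k. fst (u i) powi b i) = 1")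
      case True
      have "(\<Prod>i=1..k. r i (restrict m {1..k} i) powi b i) = (\<Prod>i=1..k. fst (u i) powi b i)"
        using m by (intro prod.cong) auto
      moreover have "restrict m {1..k} \<in> (\<Pi>\<^sub>E i\<in>{1..k}. {1..d i})"
        using m by auto
      ultimately have "\<not> (\<forall>m\<in>(\<Pi>\<^sub>E i\<in>{1..k}. {1..d i}). (\<Prod>i=1..k. r i (m i) powi b i) \<noteq> 1)"
        using True by metis
      then have B: "?B = 1 + (\<Sum>i\<in>{i\<in>{1..k}. a i = 0}. \<Delta> i)"
        by (rule if_not_P)
      \<comment> \<open>The exponent is strictly below the multiplicity, hence at most
        \<open>e i (m i) - 1\<close>, one of the numbers whose maximum is
        \<open>\<Delta> i\<close>.\<close>
      have "snd (u i) \<le> \<Delta> i" if i: "i \<in> {1..k}" for i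
      proof -
        have "snd (u i) \<le> e i (m i) - 1"
          using u(2)[OF i] assms(7)[OF i] m[OF i] by simp
        also have "\<dots> \<le> \<Delta> i"
          unfolding assms(8)[OF i] using m[OF i] by (intro Max_ge) auto
        finally show ?thesis .
      qed
      then have "1 + (\<Sum>i\<in>{i\<in>{1..k}. a i = 0}. snd (u i)) \<le> ?B"
        unfolding B by (intro add_left_mono sum_mono) auto
      then show ?thesis
        unfolding W_def by (intro resonant_sum nz[OF _ u(1)] u(3) True)
    next
      case False
      then show ?thesis
        unfolding W_def by (intro nonresonant_sum nz[OF _ u(1)] u(3))
    qed
  qed
  finally show ?thesis
    unfolding closed_forms_def by simp
qed

end
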